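(* Let $X$ be a Banach space, let $M\subset X$ be a nonempty, closed and bounded set with $\|u\|\ge 1$ for every $u\in M$ and such that $\operatorname{cone}(M)$ is convex, and let $f\colon X\to\mathbb{R}$ be lower semicontinuous. Then the problem of minimizing $f$ over $X$ is Tykhonov well-posed with respect to $M$ if and only if there exists $\bar x\in X$ such that $f$ is bounded from below on $D_{\bar x}$ and $$\operatorname{diam}(\mathcal{L}(\bar x,\epsilon))\to 0\quad\text{as }\epsilon\to 0,$$ where, for $\epsilon>0$, $$\mathcal{L}(\bar x,\epsilon):=\Big\{y\in D_{\bar x}\ \Big|\ f(y)\le \inf_{x\in D_{\bar x}}f(x)+\epsilon\Big\}.$$
   Context: $\operatorname{cone}(M)=\{\lambda u\mid \lambda\ge 0,\ u\in M\}$ and $\operatorname{diam}(C)=\sup\{\|x-y\|\mid x,y\in C\}$. The minimal time function with respect to $M$ is $T_M(y,x):=\inf\{t\ge 0\mid x\in y+tM\}\in[0,\infty]$ for $y,x\in X$, with $\inf\emptyset=\infty$. For $x\in X$, $D_x:=\{z\in X\mid T_M(z,x)<\infty\}$. A point $\bar x$ is a global minimum point of $f$ with respect to $M$ on $D_{\bar x}$ if $f(\bar x)\le f(x)$ for all $x\in D_{\bar x}$; it is the unique such point on $D_{\bar x}$ if moreover $f(\bar x)<f(x)$ for all $x\in D_{\bar x}\setminus\{\bar x\}$. The problem of minimizing $f$ over $X$ is Tykhonov well-posed with respect to $M$ if there exists $\bar x\in X$ such that (i) $\bar x$ is the unique global minimum point of $f$ with respect to $M$ on $D_{\bar x}$,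 and (ii) for every sequence $(x_k)\subset D_{\bar x}$ with $f(x_k)\to f(\bar x)$, one has $T_M(x_k,\bar x)\to 0$ as $k\to\infty$. *)

theory Defs
  imports "HOL-Analysis.Analysis"
begin

definition minimal_time :: "'a::real_vector set \<Rightarrow> 'a \<Rightarrow> 'a \<Rightarrow> ennreal" where
  "minimal_time M y x = Inf {ennreal t | t. 0 \<le> t \<and> x \<in> (\<lambda>u. y + t *\<^sub>R u) ` M}"

definition finite_time_dom :: "'a::real_vector set \<Rightarrow> 'a \<Rightarrow> 'a set" where
  "finite_time_dom M x = {z. minimal_time M z x < \<infinity>}"

(* The library's diameter is real-valued and carries no information on unbounded sets;
   this one takes values in [0, \<infinity>]. *)
definition ediam :: "'a::real_normed_vector set \<Rightarrow> ennreal" where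
  "ediam C = (SUP (x, y)\<in>C \<times> C. ennreal (norm (x - y)))"

definition lower_semicont :: "('a::topological_space \<Rightarrow> real) \<Rightarrow> bool" where
  "lower_semicont f \<longleftrightarrow> (\<forall>x. \<forall>a < f x. \<forall>\<^sub>F y in nhds x. a < f y)"

definition unique_global_min_wrt :: "'a::real_vector set \<Rightarrow> ('a \<Rightarrow> real) \<Rightarrow> 'a \<Rightarrow> bool" where
  "unique_global_min_wrt M f xbar \<longleftrightarrow>
     (\<forall>x \<in> finite_time_dom M xbar. f xbar \<le> f x) \<and>
     (\<forall>x \<in> finite_time_dom M xbar - {xbar}. f xbar < f x)"

definition tykhonov_well_posed_wrt ::
  "'a::real_vector set \<Rightarrow> ('a \<Rightarrow> real) \<Rightarrow> bool" where
  "tykhonov_well_posed_wrt M f \<longleftrightarrow>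
     (\<exists>xbar. unique_global_min_wrt M f xbar \<and>
       (\<forall>xs :: nat \<Rightarrow> 'a.
          (\<forall>k. xs k \<in> finite_time_dom M xbar) \<longrightarrow> (\<lambda>k. f (xs k)) \<longlonglongrightarrow> f xbar \<longrightarrow>
          (\<lambda>k. minimal_time M (xs k) xbar) \<longlonglongrightarrow> 0))"

(* The infimum is taken in the extended reals, so it is -\<infinity> when f is unbounded below. *)
definition approx_min_set ::
  "'a::real_vector set \<Rightarrow> ('a \<Rightarrow> real) \<Rightarrow> 'a \<Rightarrow> real \<Rightarrow> 'a set" where
  "approx_min_set M f xbar \<epsilon> =
     {y \<in> finite_time_dom M xbar.
        ereal (f y) \<le> (INF x\<in>finite_time_dom M xbar. ereal (f x)) + ereal \<epsilon>}"

end

theory Submission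
  imports Defs
begin

text \<open>The domain of \<open>x\<close> is the translated cone \<open>x - cone M\<close>, on which the minimal time function
  is equivalent to the distance because \<open>M\<close> is bounded and bounded away from \<open>0\<close>.
  Hence condition (ii) of well-posedness is norm convergence of minimizing sequences, i.e. shrinking
  of the approximate minimum sets. Conversely, approximate minimizers on the domain of \<open>x\<close> form a
  Cauchy sequence; \<open>cone M\<close> is closed, so the limit \<open>y\<close> stays in the domain and minimizes \<open>f\<close>
  there by lower semicontinuity. Convexity of the cone makes the domain of \<open>y\<close> a subset of that
  of \<open>x\<close>, so \<open>y\<close> witnesses well-posedness.\<close>

section \<open>Geometry of the domain: a translated cone, closed and transitive\<close>

lemma finite_time_dom_iff:
  "z \<in> finite_time_dom M x \<longleftrightarrow> (\<exists>t\<ge>0. \<exists>u\<in>M. x - z = t *\<^sub>R u)"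
proof -
  \<comment> \<open>An infimum is below infinity iff some member is, and every
    \<open>ennreal t\<close> is finite; so only the existence of an admissible time matters.\<close>
  have "z \<in> finite_time_dom M x \<longleftrightarrow> (\<exists>t\<ge>0. \<exists>u\<in>M. x = z + t *\<^sub>R u)"
    unfolding finite_time_dom_def minimal_time_def mem_Collect_eq Inf_less_iff image_iff
      infinity_ennreal_def
    using ennreal_less_top by blast
  then show ?thesis
    by (simp only: diff_eq_eq add.commute[of z])
qed

lemma finite_time_dom_iff_cone_hull:
  assumes "M \<noteq> {}"
  shows "z \<in> finite_time_dom M x \<longleftrightarrow> x - z \<in> cone hull M"
  by (auto simp: finite_time_dom_iff cone_hull_expl)

lemma finite_time_dom_refl:
  assumes "M \<noteq> {}"
  shows "x \<in> finite_time_dom M x"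
  using assms by (auto simp: finite_time_dom_iff intro!: exI[of _ 0])

text \<open>A convex cone is closed under addition, and \<open>x - z\<close> is the sum of
  \<open>x - y\<close> and \<open>y - z\<close>.\<close>

lemma finite_time_dom_trans:
  assumes "M \<noteq> {}" "convex (cone hull M)"
    and "y \<in> finite_time_dom M x" "z \<in> finite_time_dom M y"
  shows "z \<in> finite_time_dom M x"
proof -
  have "(x - y) + (y - z) \<in> cone hull M"
    using assms convex_cone[of "cone hull M"] cone_cone_hull[of M]
    unfolding finite_time_dom_iff_cone_hull[OF assms(1)] by blast
  then show ?thesis
    using assms(1) by (simp add: finite_time_dom_iff_cone_hull)
qed

text \<open>For a convergent sequence \<open>t n *\<^sub>R u n\<close>, the bound
  \<open>norm u \<ge> 1\<close> keeps the coefficients bounded, so a subsequence of them converges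
  to some \<open>s\<close>. A nonzero limit forces \<open>s \<noteq> 0\<close> because
  \<open>M\<close> is bounded; dividing by the coefficients then gives a sequence in the closed set
  \<open>M\<close>.\<close>

lemma closed_cone_hull:
  fixes M :: "'a::real_normed_vector set"
  assumes "closed M" "bounded M" and ge1: "\<And>u. u \<in> M \<Longrightarrow> 1 \<le> norm u"
  shows "closed (cone hull M)"
proof (cases "M = {}")
  case False
  show ?thesis
    unfolding closed_sequential_limits
  proof (intro allI impI, elim conjE)
    fix v l assume v: "\<forall>n. v n \<in> cone hull M" and lim: "v \<longlonglongrightarrow> l"
    have "\<forall>n. \<exists>t u. 0 \<le> t \<and> u \<in> M \<and> v n = t *\<^sub>R u"
      using v unfolding cone_hull_expl by blast
    then obtain t u where t: "\<And>n. 0 \<le> t n" and u: "\<And>n. u n \<in> M"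
      and vtu: "\<And>n. v n = t n *\<^sub>R u n"
      by metis
    obtain R where R: "R > 0" "\<And>u. u \<in> M \<Longrightarrow> norm u \<le> R"
      using \<open>bounded M\<close> by (auto simp: bounded_pos)
    have t_le: "t n \<le> norm (v n)" for n
      using mult_left_mono[OF ge1[OF u] t, of n n] t[of n] by (simp add: vtu)
    have t_ge: "norm (v n) \<le> t n * R" for n
      using mult_left_mono[OF R(2)[OF u] t, of n n] t[of n] by (simp add: vtu)
    obtain B where B: "\<And>n. norm (v n) \<le> B"
      using convergent_imp_bounded[OF lim] by (auto simp: bounded_iff)
    have "t n \<in> {0..B}" for n
      using t_le[of n] B[of n] t[of n] by auto
    then obtain s r where s: "strict_mono r" "(t \<circ> r) \<longlonglongrightarrow> s" and "s \<in> {0..B}"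
      using compact_Icc[of 0 B] unfolding compact_def by metis
    have vr: "(v \<circ> r) \<longlonglongrightarrow> l"
      using lim s(1) by (rule LIMSEQ_subseq_LIMSEQ)
    show "l \<in> cone hull M"
    proof (cases "l = 0")
      case True
      then show ?thesis
        using False cone_hull_contains_0 by blast
    next
      case l: False
      have "norm l \<le> s * R"
        using tendsto_norm[OF vr] tendsto_mult[OF s(2) tendsto_const[of R]]
        by (rule LIMSEQ_le) (use t_ge in auto)
      then have "s \<noteq> 0"
        using l by auto
      then have "(\<lambda>n. inverse ((t \<circ> r) n) *\<^sub>R (v \<circ> r) n) \<longlonglongrightarrow> inverse s *\<^sub>R l"
        by (intro tendsto_intros s vr)
      \<comment> \<open>Where the coefficient is nonzero, the quotient is just
        \<open>u (r n)\<close>; since \<open>s \<noteq> 0\<close>, this holds for all large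
        \<open>n\<close>.\<close>
      moreover have "\<forall>\<^sub>F n in sequentially. inverse ((t \<circ> r) n) *\<^sub>R (v \<circ> r) n \<in> M"
        using tendsto_imp_eventually_ne[OF s(2) \<open>s \<noteq> 0\<close>]
        by eventually_elim (use u in \<open>simp add: vtu\<close>)
      ultimately have "inverse s *\<^sub>R l \<in> M"
        using Lim_in_closed_set[OF \<open>closed M\<close>] by fastforce
      moreover have "l = s *\<^sub>R (inverse s *\<^sub>R l)"
        using \<open>s \<noteq> 0\<close> by simp
      ultimately show ?thesis
        using False \<open>s \<in> {0..B}\<close> unfolding cone_hull_expl[of M]
        by (metis (mono_tags, lifting) atLeastAtMost_iff mem_Collect_eq)
    qed
  qed
\<comment> \<open>The empty set is vacuously a cone, hence its own hull.\<close>
qed (simp add: hull_unique[of "{}" "{}" cone])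

lemma closed_finite_time_dom:
  fixes M :: "'a::real_normed_vector set"
  assumes "M \<noteq> {}" "closed M" "bounded M" "\<And>u. u \<in> M \<Longrightarrow> 1 \<le> norm u"
  shows "closed (finite_time_dom M x)"
proof -
  have "finite_time_dom M x = (\<lambda>z. x - z) -` (cone hull M)"
    using finite_time_dom_iff_cone_hull[OF assms(1)] by blast
  then show ?thesis
    using closed_cone_hull[OF assms(2-4)]
    by (auto intro: continuous_closed_vimage)
qed

section \<open>Comparison of minimal time and distance\<close>

lemma minimal_time_le_norm:
  fixes M :: "'a::real_normed_vector set"
  assumes "\<And>u. u \<in> M \<Longrightarrow> 1 \<le> norm u" and "z \<in> finite_time_dom M x"
  shows "minimal_time M z x \<le> ennreal (norm (x - z))"
proof -
  obtain t u where t: "0 \<le> t" "u \<in> M" "x - z = t *\<^sub>R u"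
    using assms(2) by (auto simp: finite_time_dom_iff)
  then have "x = z + t *\<^sub>R u"
    by (auto simp: algebra_simps)
  then have "minimal_time M z x \<le> ennreal t"
    unfolding minimal_time_def using t by (auto intro!: Inf_lower)
  also have "t \<le> norm (x - z)"
    using mult_left_mono[OF assms(1)[OF t(2)] t(1)] t by simp
  finally show ?thesis
    by (simp add: ennreal_leI)
qed

text \<open>Every admissible time \<open>t\<close> satisfies
  \<open>norm (x - z) \<le> t * R\<close>. If there is none, the infimum is infinite, so
  \<open>z\<close> may be arbitrary.\<close>

lemma norm_le_minimal_time:
  fixes M :: "'a::real_normed_vector set"
  assumes "\<And>u. u \<in> M \<Longrightarrow> norm u \<le> R" and "0 < R"
  shows "ennreal (norm (x - z) / R) \<le> minimal_time M z x"
  unfolding minimal_time_def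
proof (rule Inf_greatest)
  fix a assume "a \<in> {ennreal t |t. 0 \<le> t \<and> x \<in> (\<lambda>u. z + t *\<^sub>R u) ` M}"
  then obtain t u where t: "a = ennreal t" "0 \<le> t" "u \<in> M" "x = z + t *\<^sub>R u"
    by auto
  have "norm (x - z) \<le> t * R"
    using mult_left_mono[OF assms(1)[OF t(3)] t(2)] t by simp
  then show "ennreal (norm (x - z) / R) \<le> a"
    using t \<open>0 < R\<close> by (auto intro!: ennreal_leI simp: field_simps)
qed

section \<open>Diameters and approximate minimum sets\<close>

lemma norm_le_ediam:
  assumes "x \<in> C" "y \<in> C"
  shows "ennreal (norm (x - y)) \<le> ediam C"
  unfolding ediam_def using assms by (auto intro!: SUP_upper2[of "(x, y)"])

lemma ediam_le:
  assumes "\<And>y. y \<in> C \<Longrightarrow> norm (y - x) \<le> d"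
  shows "ediam C \<le> ennreal (2 * d)"
  unfolding ediam_def
proof (rule SUP_least, clarify)
  fix a b assume "a \<in> C" "b \<in> C"
  then have "norm (a - b) \<le> 2 * d"
    using assms[of a] assms[of b] norm_triangle_ineq4[of "a - x" "b - x"] by simp
  then show "ennreal (norm (a - b)) \<le> ennreal (2 * d)"
    by (rule ennreal_leI)
qed

text \<open>On a nonempty domain where \<open>f\<close> is bounded below, the extended-real infimum
  is the real one, so later arguments can stay in the reals.\<close>

lemma approx_min_set_iff:
  assumes "M \<noteq> {}" and "bdd_below (f ` finite_time_dom M x)"
  shows "y \<in> approx_min_set M f x \<epsilon> \<longleftrightarrow>
    y \<in> finite_time_dom M x \<and> f y \<le> (INF z\<in>finite_time_dom M x. f z) + \<epsilon>"
proof -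
  let ?D = "finite_time_dom M x"
  have ne: "?D \<noteq> {}"
    using finite_time_dom_refl[OF assms(1)] by auto
  have "(INF z\<in>?D. ereal (f z)) = ereal (INF z\<in>?D. f z)"
  proof (rule INF_eqI)
    show "ereal (INF z\<in>?D. f z) \<le> ereal (f i)" if "i \<in> ?D" for i
      using cINF_lower[OF assms(2) that] by simp
  next
    fix b assume b: "\<And>i. i \<in> ?D \<Longrightarrow> b \<le> ereal (f i)"
    show "b \<le> ereal (INF z\<in>?D. f z)"
    proof (cases b)
      case (real r)
      then show ?thesis
        using b by (auto intro!: cINF_greatest ne)
    \<comment> \<open>A lower bound of real values cannot be \<infinity> on a nonempty domain, and
      -\<infinity> is trivial.\<close>
    qed (use b ne in auto)
  qed
  then show ?thesis
    by (simp add: approx_min_set_def)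
qed

text \<open>The minimizer \<open>x\<close> itself is the witness: approximate minimizers staying
  away from it would form a minimizing sequence that violates \<open>seq\<close>.\<close>

lemma tykhonov_imp_ediam_tendsto_zero:
  fixes M :: "'a::real_normed_vector set"
  assumes "M \<noteq> {}" and "bounded M"
    and min: "unique_global_min_wrt M f x"
    and seq: "\<And>xs :: nat \<Rightarrow> 'a. (\<And>k. xs k \<in> finite_time_dom M x) \<Longrightarrow>
      (\<lambda>k. f (xs k)) \<longlonglongrightarrow> f x \<Longrightarrow> (\<lambda>k. minimal_time M (xs k) x) \<longlonglongrightarrow> 0"
  shows "bdd_below (f ` finite_time_dom M x)"
    and "((\<lambda>\<epsilon>. ediam (approx_min_set M f x \<epsilon>)) \<longlongrightarrow> 0) (at_right 0)"
proof -
  let ?D = "finite_time_dom M x"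
  have le: "f x \<le> f y" if "y \<in> ?D" for y
    using min that by (auto simp: unique_global_min_wrt_def)
  then show bdd: "bdd_below (f ` ?D)"
    by (auto intro!: bdd_belowI)
  have inf: "(INF z\<in>?D. f z) = f x"
    using le finite_time_dom_refl[OF \<open>M \<noteq> {}\<close>, of x] by (auto intro!: cInf_eq_minimum)
  note mem = approx_min_set_iff[OF \<open>M \<noteq> {}\<close> bdd, unfolded inf]
  obtain R where R: "R > 0" "\<And>u. u \<in> M \<Longrightarrow> norm u \<le> R"
    using \<open>bounded M\<close> by (auto simp: bounded_pos)
  have ball: "\<exists>e>0. \<forall>y\<in>approx_min_set M f x e. norm (y - x) \<le> d" if "d > 0" for d
  proof (rule ccontr)
    assume "\<not> ?thesis"
    then have "\<forall>n. \<exists>y\<in>approx_min_set M f x (inverse (real (Suc n))). d < norm (y - x)"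
      by (meson inverse_positive_iff_positive not_le of_nat_0_less_iff zero_less_Suc)
    then obtain y where y: "\<And>n. y n \<in> approx_min_set M f x (inverse (real (Suc n)))"
      and far: "\<And>n. d < norm (y n - x)"
      by metis
    have D: "y n \<in> ?D" and up: "f (y n) \<le> f x + inverse (real (Suc n))" for n
      using y[of n] unfolding mem by auto
    have "(\<lambda>n. f x + inverse (real (Suc n))) \<longlonglongrightarrow> f x"
      using LIMSEQ_inverse_real_of_nat_add .
    from tendsto_sandwich[OF _ _ tendsto_const this] have "(\<lambda>n. f (y n)) \<longlonglongrightarrow> f x"
      using D up le by simp
    then have "(\<lambda>n. minimal_time M (y n) x) \<longlonglongrightarrow> 0"
      using seq D by blast
    \<comment> \<open>A point farther than \<open>d\<close> from \<open>x\<close> has minimal time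
      at least \<open>d / R\<close>, which contradicts the limit 0.\<close>
    moreover have "0 < ennreal (d / R)"
      using \<open>d > 0\<close> \<open>R > 0\<close> by simp
    ultimately have "\<forall>\<^sub>F n in sequentially. minimal_time M (y n) x < ennreal (d / R)"
      by (rule order_tendstoD(2))
    then obtain n where "minimal_time M (y n) x < ennreal (d / R)"
      by (auto simp: eventually_sequentially)
    moreover have "ennreal (d / R) \<le> ennreal (norm (x - y n) / R)"
      using far[of n] \<open>R > 0\<close> by (intro ennreal_leI divide_right_mono) (auto simp: norm_minus_commute)
    ultimately show False
      using norm_le_minimal_time[OF R(2,1), of M x "y n"] by auto
  qed
  show "((\<lambda>\<epsilon>. ediam (approx_min_set M f x \<epsilon>)) \<longlongrightarrow> 0) (at_right 0)"
  proof (rule order_tendstoI)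
    fix a :: ennreal assume "0 < a"
    \<comment> \<open>As \<open>a\<close> may be infinite, a finite \<open>r\<close> is put below
      it. Radius \<open>r / 2\<close> around \<open>x\<close> then gives diameter at most
      \<open>r\<close>.\<close>
    then obtain r where r: "0 < ennreal r" "ennreal r < a"
      by (metis dense ennreal_cases less_top_ennreal order_less_trans top.not_eq_extremum)
    then obtain e where e: "e > 0" "\<And>y. y \<in> approx_min_set M f x e \<Longrightarrow> norm (y - x) \<le> r / 2"
      using ball[of "r / 2"] by auto
    have "ediam (approx_min_set M f x \<epsilon>) < a" if "\<epsilon> < e" for \<epsilon>
    proof -
      \<comment> \<open>The approximate minimum sets grow with \<epsilon>, so the bound at
        \<open>e\<close> serves all smaller levels.\<close>
      have "norm (y - x) \<le> r / 2" if "y \<in> approx_min_set M f x \<epsilon>" for y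
        using that \<open>\<epsilon> < e\<close> by (intro e(2)) (auto simp: mem)
      then have "ediam (approx_min_set M f x \<epsilon>) \<le> ennreal (2 * (r / 2))"
        by (rule ediam_le)
      then show ?thesis
        using r(2) by (simp add: le_less_trans)
    qed
    then show "\<forall>\<^sub>F \<epsilon> in at_right 0. ediam (approx_min_set M f x \<epsilon>) < a"
      using \<open>e > 0\<close> by (auto simp: eventually_at_right_field)
  qed simp
qed

text \<open>The point \<open>x\<close> supplies the domain; the witness is the limit
  \<open>xb\<close> of a minimizing sequence and may differ from \<open>x\<close>.\<close>

lemma ediam_tendsto_zero_imp_tykhonov:
  fixes M :: "'a::banach set"
  assumes "M \<noteq> {}" and "closed M" and "bounded M"
    and ge1: "\<And>u. u \<in> M \<Longrightarrow> 1 \<le> norm u"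
    and conv: "convex (cone hull M)"
    and lsc: "lower_semicont f"
    and bdd: "bdd_below (f ` finite_time_dom M x)"
    and diam: "((\<lambda>\<epsilon>. ediam (approx_min_set M f x \<epsilon>)) \<longlongrightarrow> 0) (at_right 0)"
  shows "tykhonov_well_posed_wrt M f"
proof -
  let ?D = "finite_time_dom M x"
  define m where "m = (INF z\<in>?D. f z)"
  note mem = approx_min_set_iff[OF \<open>M \<noteq> {}\<close> bdd, folded m_def]
  have lower: "m \<le> f z" if "z \<in> ?D" for z
    unfolding m_def using bdd that by (rule cINF_lower)
  \<comment> \<open>The shrinking diameters as a uniform modulus. It is used three times: for the
    Cauchy property, for uniqueness, and for convergence of minimizing sequences. The level
    \<open>b / 2\<close> below lies strictly inside the interval where the diameter is
    controlled.\<close>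
  have small: "\<exists>e>0. \<forall>y z. y \<in> ?D \<longrightarrow> z \<in> ?D \<longrightarrow> f y \<le> m + e \<longrightarrow> f z \<le> m + e \<longrightarrow> norm (y - z) < d"
    if "d > 0" for d
  proof -
    have "\<forall>\<^sub>F \<epsilon> in at_right 0. ediam (approx_min_set M f x \<epsilon>) < ennreal d"
      using diam by (rule order_tendstoD(2)) (use that in simp)
    then obtain b where b: "b > 0"
      "\<And>\<epsilon>. 0 < \<epsilon> \<Longrightarrow> \<epsilon> < b \<Longrightarrow> ediam (approx_min_set M f x \<epsilon>) < ennreal d"
      by (auto simp: eventually_at_right_field)
    have "norm (y - z) < d" if "y \<in> ?D" "z \<in> ?D" "f y \<le> m + b / 2" "f z \<le> m + b / 2" for y z
    proof -
      have "ennreal (norm (y - z)) \<le> ediam (approx_min_set M f x (b / 2))"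
        using that by (intro norm_le_ediam) (auto simp: mem)
      also have "\<dots> < ennreal d"
        using b by auto
      finally show ?thesis
        by (simp add: ennreal_less_iff)
    qed
    then show ?thesis
      using \<open>b > 0\<close> by (intro exI[of _ "b / 2"]) auto
  qed
  have ne: "?D \<noteq> {}"
    using finite_time_dom_refl[OF \<open>M \<noteq> {}\<close>] by auto
  have "\<exists>z\<in>?D. f z \<le> m + inverse (real (Suc n))" for n
  proof -
    have "(INF z\<in>?D. f z) < m + inverse (real (Suc n))"
      by (simp add: m_def)
    then show ?thesis
      unfolding cINF_less_iff[OF ne bdd] by force
  qed
  then obtain y where y: "\<And>n. y n \<in> ?D" "\<And>n. f (y n) \<le> m + inverse (real (Suc n))"
    by metis
  have y_lim: "(\<lambda>n. m + inverse (real (Suc n))) \<longlonglongrightarrow> m"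
    using LIMSEQ_inverse_real_of_nat_add .
  have "Cauchy y"
  proof (rule metric_CauchyI)
    fix d :: real assume "d > 0"
    then obtain e where e: "e > 0"
      "\<And>y z. y \<in> ?D \<Longrightarrow> z \<in> ?D \<Longrightarrow> f y \<le> m + e \<Longrightarrow> f z \<le> m + e \<Longrightarrow> norm (y - z) < d"
      using small by meson
    have "\<forall>\<^sub>F n in sequentially. m + inverse (real (Suc n)) < m + e"
      using y_lim by (rule order_tendstoD(2)) (use e in simp)
    then obtain N where "\<And>n. n \<ge> N \<Longrightarrow> m + inverse (real (Suc n)) < m + e"
      by (auto simp: eventually_sequentially)
    then have "f (y n) \<le> m + e" if "n \<ge> N" for n
      using y(2)[of n] that by (meson order.strict_implies_order order.trans)
    then show "\<exists>N. \<forall>i\<ge>N. \<forall>j\<ge>N. dist (y i) (y j) < d"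
      unfolding dist_norm using e(2) y(1) by blast
  qed
  then obtain xb where lim: "y \<longlonglongrightarrow> xb"
    using Cauchy_convergent convergent_def by blast
  have xb: "xb \<in> ?D"
    using closed_finite_time_dom[OF assms(1-4)] y(1) lim by (rule closed_sequentially)
  \<comment> \<open>By lower semicontinuity any \<open>a < f xb\<close> is eventually below
    \<open>f (y n)\<close>, whose upper bounds tend to \<open>m\<close>; hence
    \<open>a \<le> m\<close>.\<close>
  have "f xb \<le> m"
  proof (rule dense_le)
    fix a assume "a < f xb"
    then have "\<forall>\<^sub>F n in sequentially. a < f (y n)"
      using lsc lim by (auto simp: lower_semicont_def filterlim_iff)
    then have "\<forall>\<^sub>F n in sequentially. a \<le> m + inverse (real (Suc n))"
      by eventually_elim (meson y(2) less_le_trans order.strict_implies_order)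
    with y_lim show "a \<le> m"
      by (rule tendsto_lowerbound) simp
  qed
  with lower[OF xb] have f_xb: "f xb = m"
    by simp
  have sub: "finite_time_dom M xb \<subseteq> ?D"
    using finite_time_dom_trans[OF \<open>M \<noteq> {}\<close> conv xb] by auto
  have "unique_global_min_wrt M f xb"
  proof -
    \<comment> \<open>Both points lie in every approximate minimum set, so the modulus at
      \<open>d = norm (z - xb)\<close> would make this distance smaller than itself.\<close>
    have "z = xb" if "z \<in> ?D" "f z \<le> m" for z
    proof (rule ccontr)
      assume "z \<noteq> xb"
      then have "0 < norm (z - xb)"
        by simp
      from small[OF this] obtain e where "e > 0"
        "\<And>y y'. y \<in> ?D \<Longrightarrow> y' \<in> ?D \<Longrightarrow> f y \<le> m + e \<Longrightarrow> f y' \<le> m + e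
          \<Longrightarrow> norm (y - y') < norm (z - xb)"
        by meson
      from this(2)[OF that(1) xb] this(1) show False
        using that(2) f_xb by simp
    qed
    then show ?thesis
      using sub lower f_xb by (force simp: unique_global_min_wrt_def)
  qed
  moreover have "(\<lambda>k. minimal_time M (xs k) xb) \<longlonglongrightarrow> 0"
    if xs: "\<forall>k. xs k \<in> finite_time_dom M xb" and fxs: "(\<lambda>k. f (xs k)) \<longlonglongrightarrow> f xb" for xs :: "nat \<Rightarrow> 'a"
  proof -
    \<comment> \<open>Eventually \<open>xs k\<close> and \<open>xb\<close> lie in a common
      approximate minimum set over \<open>?D\<close>, thanks to \<open>sub\<close>. The norm then
      dominates the minimal time.\<close>
    have "(\<lambda>k. norm (xb - xs k)) \<longlonglongrightarrow> 0"
    proof (rule order_tendstoI)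
      fix d :: real assume "0 < d"
      then obtain e where e: "e > 0"
        "\<And>y z. y \<in> ?D \<Longrightarrow> z \<in> ?D \<Longrightarrow> f y \<le> m + e \<Longrightarrow> f z \<le> m + e \<Longrightarrow> norm (y - z) < d"
        using small by meson
      have "\<forall>\<^sub>F k in sequentially. f (xs k) < m + e"
        using fxs by (rule order_tendstoD(2)) (use e f_xb in simp)
      then show "\<forall>\<^sub>F k in sequentially. norm (xb - xs k) < d"
        by eventually_elim (use e xb xs sub f_xb in \<open>intro e(2), auto\<close>)
    qed (auto intro!: always_eventually intro: less_le_trans)
    then have "(\<lambda>k. ennreal (norm (xb - xs k))) \<longlonglongrightarrow> 0"
      using tendsto_ennrealI by fastforce
    from tendsto_sandwich[OF _ _ tendsto_const this] show ?thesis
      using xs minimal_time_le_norm[OF ge1] by simp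
  qed
  ultimately show ?thesis
    unfolding tykhonov_well_posed_wrt_def by blast
qed

theorem theorem4p1:
  fixes M :: "'a::banach set" and f :: "'a \<Rightarrow> real"
  assumes "M \<noteq> {}" and "closed M" and "bounded M"
    and "\<And>u. u \<in> M \<Longrightarrow> 1 \<le> norm u"
    and "convex (cone hull M)"
    and "lower_semicont f"
  shows "tykhonov_well_posed_wrt M f \<longleftrightarrow>
    (\<exists>xbar. bdd_below (f ` finite_time_dom M xbar) \<and>
       ((\<lambda>\<epsilon>. ediam (approx_min_set M f xbar \<epsilon>)) \<longlongrightarrow> 0) (at_right 0))"
proof
  assume "tykhonov_well_posed_wrt M f"
  then obtain x where "unique_global_min_wrt M f x"
    "\<And>xs :: nat \<Rightarrow> 'a. (\<And>k. xs k \<in> finite_time_dom M x) \<Longrightarrow>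
      (\<lambda>k. f (xs k)) \<longlonglongrightarrow> f x \<Longrightarrow> (\<lambda>k. minimal_time M (xs k) x) \<longlonglongrightarrow> 0"
    unfolding tykhonov_well_posed_wrt_def by blast
  from tykhonov_imp_ediam_tendsto_zero[OF assms(1,3) this]
  show "\<exists>xbar. bdd_below (f ` finite_time_dom M xbar) \<and>
       ((\<lambda>\<epsilon>. ediam (approx_min_set M f xbar \<epsilon>)) \<longlongrightarrow> 0) (at_right 0)"
    by blast
qed (use ediam_tendsto_zero_imp_tykhonov[OF assms] in blast)

end
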